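(* Let $(R_1,f_1,g_1)$ and $(R_2,f_2,g_2)$ be two commutative Krasner $(m,n)$-hyperrings with scalar identities $1_{R_1}$ and $1_{R_2}$, respectively. Let $S=S_1\times S_2$, where $S_1$ and $S_2$ are $n$-ary multiplicative subsets of $R_1$ and $R_2$, respectively, and let $I_1\subseteq R_1$. Then $I_1$ is an $n$-ary $S_1$-prime hyperideal of $R_1$ if and only if $I_1\times R_2$ is an $n$-ary $S$-prime hyperideal of $R_1\times R_2$.
   Context: Notation: $x_i^j$ denotes the sequence $x_i,\dots,x_j$ (empty if $j<i$); $x^{(k)}$ denotes $x$ repeated $k$ times; operations are extended to subsets elementwise (taking unions); $m,n\ge 2$ are integers. An $m$-ary hyperoperation on $R$ is a map $f$ from $R^m$ to the nonempty subsets of $R$. $(R,f)$ is a (commutative) canonical $m$-ary hypergroup if $f$ is invariant under permuting its arguments; $f$ is associative, i.e. $f(x_1^{i-1},f(x_i^{m+i-1}),x_{m+i}^{2m-1})$ does not depend on $i$; for all $a_1^{i-1},a_{i+1}^m,b\in R$ there is $x\in R$ with $b\in f(a_1^{i-1},x,a_{i+1}^m)$; there is a unique $0\in R$ with $f(x,0^{(m-1)})=\{x\}$ for all $x$; each $x$ has a unique $-x$ with $0\in f(x,-x,0^{(m-2)})$; and $x\in f(x_1^m)$ implies $x_i\in f(x,-x_1,\dots,-x_{i-1},-x_{i+1},\dots,-x_m)$ for all $i$. A commutative Krasner $(m,n)$-hyperring $(R,f,g)$ is such an $(R,f)$ together with an associative, permutation-invariant $n$-ary operation $g:R^n\to R$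 that is distributive over $f$ in each argument, i.e. $g(a_1^{i-1},f(x_1^m),a_{i+1}^n)=f(g(a_1^{i-1},x_1,a_{i+1}^n),\dots,g(a_1^{i-1},x_m,a_{i+1}^n))$, and satisfies $g(0,x_2^n)=0$. A scalar identity is an element $1$ with $g(x,1^{(n-1)})=x$ for all $x$. The product $R_1\times R_2$ is the Krasner $(m,n)$-hyperring with $(f_1\times f_2)((a_1,b_1),\dots,(a_m,b_m))=\{(a,b)\mid a\in f_1(a_1^m),\ b\in f_2(b_1^m)\}$ and $(g_1\times g_2)((x_1,y_1),\dots,(x_n,y_n))=(g_1(x_1^n),g_2(y_1^n))$; its scalar identity is $(1_{R_1},1_{R_2})$. A hyperideal of $R$ is a nonempty $I\subseteq R$ such that $(I,f)$ is an $m$-ary subhypergroup of $(R,f)$ (i.e. $f(x_1^m)\subseteq I$ for $x_1^m\in I$, and $b\in f(b_1^{i-1},x,b_{i+1}^m)$ has a solution $x\in I$ whenever all $b$'s lie in $I$) and $g(x_1^{i-1},I,x_{i+1}^n)\subseteq I$ for all $x_j\in R$ and all $i$. An $n$-ary multiplicative subset is a nonempty $S\subseteq R$ with $g(s_1^n)\in S$ for all $s_1^n\in S$. A hyperideal $I$ with $I\cap S=\varnothing$ is an $n$-ary $S$-prime hyperideal if there exists $s\in S$ such that for all $x_1^n\in R$ with $g(x_1^n)\in I$ one has $g(s,x_i,1^{(n-2)})\in I$ for some $1\le i\le n$. *)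

theory Defs
  imports "HOL-Library.NList" "HOL-Library.Multiset"
begin

text \<open>
  A $k$-ary (hyper)operation on a carrier \<open>R\<close> is a function on lists, of which only the values on
  \<^term>\<open>nlists k R\<close>, the lists of length \<open>k\<close> over \<open>R\<close>, matter. Pairs of lists \<open>as\<close>, \<open>bs\<close> with
  \<^prop>\<open>Suc (length as + length bs) = k\<close> stand for $a_1^{i-1}$ and $a_{i+1}^k$, for an arbitrary
  position $i$.
\<close>

definition is_hyper_zero :: "nat \<Rightarrow> 'a set \<Rightarrow> ('a list \<Rightarrow> 'a set) \<Rightarrow> 'a \<Rightarrow> bool" where
  "is_hyper_zero m R f e \<longleftrightarrow> e \<in> R \<and> (\<forall>x\<in>R. f (x # replicate (m - 1) e) = {x})"

definition hyper_zero :: "nat \<Rightarrow> 'a set \<Rightarrow> ('a list \<Rightarrow> 'a set) \<Rightarrow> 'a" where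
  "hyper_zero m R f = (THE e. is_hyper_zero m R f e)"

definition is_hyper_neg :: "nat \<Rightarrow> 'a set \<Rightarrow> ('a list \<Rightarrow> 'a set) \<Rightarrow> 'a \<Rightarrow> 'a \<Rightarrow> bool" where
  "is_hyper_neg m R f x y \<longleftrightarrow>
     y \<in> R \<and> hyper_zero m R f \<in> f (x # y # replicate (m - 2) (hyper_zero m R f))"

definition hyper_neg :: "nat \<Rightarrow> 'a set \<Rightarrow> ('a list \<Rightarrow> 'a set) \<Rightarrow> 'a \<Rightarrow> 'a" where
  "hyper_neg m R f x = (THE y. is_hyper_neg m R f x y)"

locale canonical_hypergroup =
  fixes m :: nat and R :: "'a set" and f :: "'a list \<Rightarrow> 'a set"
  assumes m_ge_2: "2 \<le> m"
    and f_subset: "xs \<in> nlists m R \<Longrightarrow> f xs \<subseteq> R"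
    and f_nonempty: "xs \<in> nlists m R \<Longrightarrow> f xs \<noteq> {}"
    and f_perm: "xs \<in> nlists m R \<Longrightarrow> mset ys = mset xs \<Longrightarrow> f ys = f xs"
    and f_assoc: "xs \<in> nlists (2 * m - 1) R \<Longrightarrow> i < m \<Longrightarrow> j < m \<Longrightarrow>
        (\<Union>y\<in>f (take m (drop i xs)). f (take i xs @ y # drop (i + m) xs)) =
        (\<Union>y\<in>f (take m (drop j xs)). f (take j xs @ y # drop (j + m) xs))"
    and f_solvable: "as \<in> lists R \<Longrightarrow> bs \<in> lists R \<Longrightarrow> Suc (length as + length bs) = m \<Longrightarrow>
        b \<in> R \<Longrightarrow> \<exists>x\<in>R. b \<in> f (as @ x # bs)"
    and zero_unique: "\<exists>!e. is_hyper_zero m R f e"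
    and neg_unique: "x \<in> R \<Longrightarrow> \<exists>!y. is_hyper_neg m R f x y"
    and f_reversible: "as \<in> lists R \<Longrightarrow> bs \<in> lists R \<Longrightarrow> Suc (length as + length bs) = m \<Longrightarrow>
        y \<in> R \<Longrightarrow> x \<in> f (as @ y # bs) \<Longrightarrow>
        y \<in> f (x # map (hyper_neg m R f) as @ map (hyper_neg m R f) bs)"

locale comm_krasner_hyperring = canonical_hypergroup m R f
  for m :: nat and n :: nat and R :: "'a set" and f :: "'a list \<Rightarrow> 'a set"
    and g :: "'a list \<Rightarrow> 'a" +
  assumes n_ge_2: "2 \<le> n"
    and g_closed: "xs \<in> nlists n R \<Longrightarrow> g xs \<in> R"
    and g_perm: "xs \<in> nlists n R \<Longrightarrow> mset ys = mset xs \<Longrightarrow> g ys = g xs"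
    and g_assoc: "xs \<in> nlists (2 * n - 1) R \<Longrightarrow> i < n \<Longrightarrow> j < n \<Longrightarrow>
        g (take i xs @ g (take n (drop i xs)) # drop (i + n) xs) =
        g (take j xs @ g (take n (drop j xs)) # drop (j + n) xs)"
    and g_distrib: "as \<in> lists R \<Longrightarrow> bs \<in> lists R \<Longrightarrow> Suc (length as + length bs) = n \<Longrightarrow>
        xs \<in> nlists m R \<Longrightarrow>
        (\<lambda>y. g (as @ y # bs)) ` f xs = f (map (\<lambda>x. g (as @ x # bs)) xs)"
    and g_zero: "xs \<in> nlists (n - 1) R \<Longrightarrow> g (hyper_zero m R f # xs) = hyper_zero m R f"

definition scalar_identity :: "nat \<Rightarrow> 'a set \<Rightarrow> ('a list \<Rightarrow> 'a) \<Rightarrow> 'a \<Rightarrow> bool" where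
  "scalar_identity n R g e \<longleftrightarrow> e \<in> R \<and> (\<forall>x\<in>R. g (x # replicate (n - 1) e) = x)"

definition prod_hyperop ::
  "('a list \<Rightarrow> 'a set) \<Rightarrow> ('b list \<Rightarrow> 'b set) \<Rightarrow> ('a \<times> 'b) list \<Rightarrow> ('a \<times> 'b) set" where
  "prod_hyperop f1 f2 zs = f1 (map fst zs) \<times> f2 (map snd zs)"

definition prod_op ::
  "('a list \<Rightarrow> 'a) \<Rightarrow> ('b list \<Rightarrow> 'b) \<Rightarrow> ('a \<times> 'b) list \<Rightarrow> 'a \<times> 'b" where
  "prod_op g1 g2 zs = (g1 (map fst zs), g2 (map snd zs))"

definition hyperideal ::
  "nat \<Rightarrow> nat \<Rightarrow> 'a set \<Rightarrow> ('a list \<Rightarrow> 'a set) \<Rightarrow> ('a list \<Rightarrow> 'a) \<Rightarrow> 'a set \<Rightarrow> bool" where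
  "hyperideal m n R f g I \<longleftrightarrow>
     I \<noteq> {} \<and> I \<subseteq> R \<and>
     (\<forall>xs\<in>nlists m I. f xs \<subseteq> I) \<and>
     (\<forall>as\<in>lists I. \<forall>bs\<in>lists I. \<forall>b\<in>I.
        Suc (length as + length bs) = m \<longrightarrow> (\<exists>x\<in>I. b \<in> f (as @ x # bs))) \<and>
     (\<forall>as\<in>lists R. \<forall>bs\<in>lists R. \<forall>x\<in>I.
        Suc (length as + length bs) = n \<longrightarrow> g (as @ x # bs) \<in> I)"

definition multiplicative_subset ::
  "nat \<Rightarrow> 'a set \<Rightarrow> ('a list \<Rightarrow> 'a) \<Rightarrow> 'a set \<Rightarrow> bool" where
  "multiplicative_subset n R g S \<longleftrightarrow> S \<noteq> {} \<and> S \<subseteq> R \<and> (\<forall>xs\<in>nlists n S. g xs \<in> S)"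

definition S_prime_hyperideal ::
  "nat \<Rightarrow> nat \<Rightarrow> 'a set \<Rightarrow> ('a list \<Rightarrow> 'a set) \<Rightarrow> ('a list \<Rightarrow> 'a) \<Rightarrow> 'a \<Rightarrow> 'a set \<Rightarrow> 'a set \<Rightarrow> bool" where
  "S_prime_hyperideal m n R f g e S I \<longleftrightarrow>
     multiplicative_subset n R g S \<and> hyperideal m n R f g I \<and> I \<inter> S = {} \<and>
     (\<exists>s\<in>S. \<forall>xs\<in>nlists n R. g xs \<in> I \<longrightarrow>
        (\<exists>i<n. g (s # xs ! i # replicate (n - 2) e) \<in> I))"

end

theory Submission
  imports Defs
begin

text \<open>All structure on the product is coordinatewise, and the second factor of
  \<open>I1 \<times> R2\<close> is the whole carrier. Hence an element of
  \<open>R1 \<times> R2\<close> lies in \<open>I1 \<times> R2\<close> exactly when its first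
  coordinate lies in \<open>I1\<close>, and the second coordinate only has to be kept inside
  \<open>R2\<close>, which closure of \<open>g2\<close> does. S-primeness is a conjunction, and each
  conjunct is transferred separately.

  Going up, products of hyperideals are hyperideals (\<open>hyperideal_Times\<close>), applied with
  the carrier \<open>R2\<close> as second factor (\<open>hyperideal_carrier\<close>), and a witness
  \<open>s\<close> is paired with an element of \<open>S2\<close>. Going down, lists over
  \<open>R1\<close> are lifted to the product by padding with a constant second coordinate, and
  results are projected back; this gives \<open>hyperideal_TimesD1\<close> and the descent of the
  primeness clause, with \<open>fst s\<close> as witness.\<close>

lemma nlists_Times_iff:
  "zs \<in> nlists k (A \<times> B) \<longleftrightarrow> map fst zs \<in> nlists k A \<and> map snd zs \<in> nlists k B"
  unfolding nlists_def by (auto simp: mem_Times_iff)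

lemma lists_Times_iff:
  "zs \<in> lists (A \<times> B) \<longleftrightarrow> map fst zs \<in> lists A \<and> map snd zs \<in> lists B"
  by (auto simp: in_lists_conv_set mem_Times_iff)

lemma nlists_map_Pair: "b \<in> B \<Longrightarrow> xs \<in> nlists k A \<Longrightarrow> map (\<lambda>x. (x, b)) xs \<in> nlists k (A \<times> B)"
  unfolding nlists_def by auto

lemma lists_map_Pair: "b \<in> B \<Longrightarrow> xs \<in> lists A \<Longrightarrow> map (\<lambda>x. (x, b)) xs \<in> lists (A \<times> B)"
  by (auto simp: in_lists_conv_set)

lemma multiplicative_subset_Times:
  assumes "multiplicative_subset n R1 g1 S1" and "multiplicative_subset n R2 g2 S2"
  shows "multiplicative_subset n (R1 \<times> R2) (prod_op g1 g2) (S1 \<times> S2)"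
  using assms by (auto simp: multiplicative_subset_def prod_op_def nlists_Times_iff)

text \<open>The clauses are closure and solvability of the hyperring itself, and the zero makes the
  carrier nonempty. It supplies the second factor of \<open>I1 \<times> R2\<close>.\<close>

lemma (in comm_krasner_hyperring) hyperideal_carrier: "hyperideal m n R f g R"
  unfolding hyperideal_def
proof (intro conjI ballI impI)
  show "R \<noteq> {}"
    using zero_unique unfolding is_hyper_zero_def by blast
  show "f xs \<subseteq> R" if "xs \<in> nlists m R" for xs
    using f_subset that .
  show "\<exists>x\<in>R. b \<in> f (as @ x # bs)"
    if "as \<in> lists R" "bs \<in> lists R" "b \<in> R" "Suc (length as + length bs) = m" for as bs b
    using f_solvable that by blast
  show "g (as @ x # bs) \<in> R"
    if "as \<in> lists R" "bs \<in> lists R" "x \<in> R" "Suc (length as + length bs) = n" for as bs x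
    using that by (intro g_closed nlistsI) (auto simp: in_lists_conv_set)
qed simp

lemma hyperideal_Times:
  assumes I1: "hyperideal m n R1 f1 g1 I1" and I2: "hyperideal m n R2 f2 g2 I2"
  shows "hyperideal m n (R1 \<times> R2) (prod_hyperop f1 f2) (prod_op g1 g2) (I1 \<times> I2)"
  unfolding hyperideal_def
proof (intro conjI ballI impI)
  show "I1 \<times> I2 \<noteq> {}" "I1 \<times> I2 \<subseteq> R1 \<times> R2"
    using I1 I2 by (auto simp: hyperideal_def)
  show "prod_hyperop f1 f2 zs \<subseteq> I1 \<times> I2" if "zs \<in> nlists m (I1 \<times> I2)" for zs
    using that I1 I2 unfolding hyperideal_def prod_hyperop_def nlists_Times_iff by blast
  show "\<exists>z\<in>I1 \<times> I2. b \<in> prod_hyperop f1 f2 (as @ z # bs)"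
    if "as \<in> lists (I1 \<times> I2)" "bs \<in> lists (I1 \<times> I2)" "b \<in> I1 \<times> I2"
      "Suc (length as + length bs) = m" for as bs b
  proof -
    have "\<exists>x\<in>I1. fst b \<in> f1 (map fst as @ x # map fst bs)"
      using that I1 unfolding hyperideal_def lists_Times_iff by (auto simp: mem_Times_iff)
    moreover have "\<exists>y\<in>I2. snd b \<in> f2 (map snd as @ y # map snd bs)"
      using that I2 unfolding hyperideal_def lists_Times_iff by (auto simp: mem_Times_iff)
    \<comment> \<open>The two coordinate equations are solved independently; since
      \<open>prod_hyperop\<close> takes the full Cartesian product of the values, the pair of
      solutions solves the equation in the product.\<close>
    ultimately obtain x y where "x \<in> I1" "fst b \<in> f1 (map fst as @ x # map fst bs)"
      "y \<in> I2" "snd b \<in> f2 (map snd as @ y # map snd bs)"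
      by blast
    then show ?thesis
      by (intro bexI[of _ "(x, y)"]) (auto simp: prod_hyperop_def mem_Times_iff)
  qed
  show "prod_op g1 g2 (as @ z # bs) \<in> I1 \<times> I2"
    if "as \<in> lists (R1 \<times> R2)" "bs \<in> lists (R1 \<times> R2)" "z \<in> I1 \<times> I2"
      "Suc (length as + length bs) = n" for as bs z
    using that I1 I2 unfolding hyperideal_def lists_Times_iff prod_op_def
    by (auto simp: mem_Times_iff)
qed

text \<open>Each clause for \<open>I1\<close> is the product clause on lists padded with one fixed
  second coordinate, read in the first coordinate.\<close>

lemma hyperideal_TimesD1:
  assumes I: "hyperideal m n (R1 \<times> R2) (prod_hyperop f1 f2) (prod_op g1 g2) (I1 \<times> I2)"
    and f2_nonempty: "\<And>ys. ys \<in> nlists m R2 \<Longrightarrow> f2 ys \<noteq> {}"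
  shows "hyperideal m n R1 f1 g1 I1"
proof -
  \<comment> \<open>The padding element: \<open>b \<in> I2\<close> serves the clauses on lists over
    the ideal, \<open>b \<in> R2\<close> the absorption clause, whose outer arguments range over the
    carrier.\<close>
  from I obtain b where b: "b \<in> I2" "b \<in> R2"
    by (fastforce simp: hyperideal_def)
  show ?thesis
    unfolding hyperideal_def
  proof (intro conjI ballI impI)
    show "I1 \<noteq> {}" "I1 \<subseteq> R1"
      using I b by (auto simp: hyperideal_def)
    show "f1 xs \<subseteq> I1" if xs: "xs \<in> nlists m I1" for xs
    proof -
      have "prod_hyperop f1 f2 (map (\<lambda>x. (x, b)) xs) \<subseteq> I1 \<times> I2"
        using I nlists_map_Pair[OF b(1) xs] by (simp add: hyperideal_def)
      \<comment> \<open>An inclusion between Cartesian products projects to the first factors only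
        if the smaller product has a nonempty second factor.\<close>
      moreover have "f2 (map snd (map (\<lambda>x. (x, b)) xs)) \<noteq> {}"
        using nlists_map_Pair[OF b(2) xs] by (intro f2_nonempty) (simp only: nlists_Times_iff)
      ultimately show ?thesis
        by (auto simp: prod_hyperop_def comp_def)
    qed
    show "\<exists>x\<in>I1. c \<in> f1 (as @ x # bs)"
      if "as \<in> lists I1" "bs \<in> lists I1" "c \<in> I1" "Suc (length as + length bs) = m" for as bs c
    proof -
      have "\<exists>z\<in>I1 \<times> I2. (c, b) \<in> prod_hyperop f1 f2
          (map (\<lambda>x. (x, b)) as @ z # map (\<lambda>x. (x, b)) bs)"
        using I that b lists_map_Pair[OF b(1) that(1)] lists_map_Pair[OF b(1) that(2)]
        by (simp add: hyperideal_def)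
      then show ?thesis
        by (auto simp: prod_hyperop_def comp_def)
    qed
    show "g1 (as @ x # bs) \<in> I1"
      if "as \<in> lists R1" "bs \<in> lists R1" "x \<in> I1" "Suc (length as + length bs) = n" for as bs x
    proof -
      have "prod_op g1 g2 (map (\<lambda>x. (x, b)) as @ (x, b) # map (\<lambda>x. (x, b)) bs) \<in> I1 \<times> I2"
        using I that b lists_map_Pair[OF b(2) that(1)] lists_map_Pair[OF b(2) that(2)]
        by (simp add: hyperideal_def)
      then show ?thesis
        by (simp add: prod_op_def comp_def)
    qed
  qed
qed

theorem theorem3p16:
  fixes m n :: nat
    and R1 :: "'a set" and f1 :: "'a list \<Rightarrow> 'a set" and g1 :: "'a list \<Rightarrow> 'a" and e1 :: 'a
    and R2 :: "'b set" and f2 :: "'b list \<Rightarrow> 'b set" and g2 :: "'b list \<Rightarrow> 'b" and e2 :: 'b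
    and S1 I1 :: "'a set" and S2 :: "'b set"
  assumes "comm_krasner_hyperring m n R1 f1 g1"
    and "comm_krasner_hyperring m n R2 f2 g2"
    and "scalar_identity n R1 g1 e1"
    and "scalar_identity n R2 g2 e2"
    and "multiplicative_subset n R1 g1 S1"
    and "multiplicative_subset n R2 g2 S2"
    and "I1 \<subseteq> R1"
  shows "S_prime_hyperideal m n R1 f1 g1 e1 S1 I1 \<longleftrightarrow>
         S_prime_hyperideal m n (R1 \<times> R2) (prod_hyperop f1 f2) (prod_op g1 g2) (e1, e2)
           (S1 \<times> S2) (I1 \<times> R2)"
proof -
  interpret R2: comm_krasner_hyperring m n R2 f2 g2
    by fact
  have e2: "e2 \<in> R2"
    using assms(4) by (simp add: scalar_identity_def)
  obtain t where t: "t \<in> S2"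
    using assms(6) by (auto simp: multiplicative_subset_def)
  have S2: "S2 \<subseteq> R2"
    using assms(6) by (simp add: multiplicative_subset_def)
  have mult: "multiplicative_subset n (R1 \<times> R2) (prod_op g1 g2) (S1 \<times> S2)"
    by (rule multiplicative_subset_Times) fact+
  have ideal: "hyperideal m n R1 f1 g1 I1 \<longleftrightarrow>
      hyperideal m n (R1 \<times> R2) (prod_hyperop f1 f2) (prod_op g1 g2) (I1 \<times> R2)"
    using hyperideal_Times[OF _ R2.hyperideal_carrier] hyperideal_TimesD1 R2.f_nonempty by blast
  \<comment> \<open>The right-hand intersection is \<open>(I1 \<inter> S1) \<times> S2\<close>,
    because \<open>S2 \<subseteq> R2\<close>, and \<open>S2\<close> contains
    \<open>t\<close>.\<close>
  have disjoint: "I1 \<inter> S1 = {} \<longleftrightarrow> (I1 \<times> R2) \<inter> (S1 \<times> S2) = {}"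
    using t S2 by blast
  have "(\<exists>s\<in>S1. \<forall>xs\<in>nlists n R1. g1 xs \<in> I1 \<longrightarrow>
        (\<exists>i<n. g1 (s # xs ! i # replicate (n - 2) e1) \<in> I1)) \<longleftrightarrow>
      (\<exists>s\<in>S1 \<times> S2. \<forall>zs\<in>nlists n (R1 \<times> R2). prod_op g1 g2 zs \<in> I1 \<times> R2 \<longrightarrow>
        (\<exists>i<n. prod_op g1 g2 (s # zs ! i # replicate (n - 2) (e1, e2)) \<in> I1 \<times> R2))"
    (is "?prime1 \<longleftrightarrow> ?prime")
  proof
    assume ?prime1
    then obtain s where s: "s \<in> S1" and prime: "\<And>xs. xs \<in> nlists n R1 \<Longrightarrow> g1 xs \<in> I1 \<Longrightarrow>
        \<exists>i<n. g1 (s # xs ! i # replicate (n - 2) e1) \<in> I1"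
      by blast
    \<comment> \<open>The index found for the first coordinates also works in the product, with
      \<open>(s, t)\<close> as witness.\<close>
    have "\<exists>i<n. prod_op g1 g2 ((s, t) # zs ! i # replicate (n - 2) (e1, e2)) \<in> I1 \<times> R2"
      if zs: "zs \<in> nlists n (R1 \<times> R2)" and "prod_op g1 g2 zs \<in> I1 \<times> R2" for zs
    proof -
      have "map fst zs \<in> nlists n R1" "g1 (map fst zs) \<in> I1"
        using that by (simp_all add: prod_op_def nlists_Times_iff)
      from prime[OF this] obtain i
        where i: "i < n" "g1 (s # map fst zs ! i # replicate (n - 2) e1) \<in> I1"
        by blast
      have "length zs = n"
        using zs by simp
      moreover have "zs ! i \<in> R1 \<times> R2"
        using zs i(1) by (rule nlistsE_nth_in)
      \<comment> \<open>The argument list has length \<open>n\<close> because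
        \<open>2 \<le> n\<close>, so closure of \<open>g2\<close> places the second coordinate in
        \<open>R2\<close>.\<close>
      then have "g2 (t # snd (zs ! i) # replicate (n - 2) e2) \<in> R2"
        using t S2 e2 R2.n_ge_2 by (intro R2.g_closed nlistsI) auto
      ultimately show ?thesis
        using i by (auto simp: prod_op_def map_replicate)
    qed
    then show ?prime
      using s t by (intro bexI[of _ "(s, t)"]) auto
  next
    assume ?prime
    then obtain s where s: "s \<in> S1 \<times> S2" and prime: "\<forall>zs\<in>nlists n (R1 \<times> R2).
        prod_op g1 g2 zs \<in> I1 \<times> R2 \<longrightarrow>
        (\<exists>i<n. prod_op g1 g2 (s # zs ! i # replicate (n - 2) (e1, e2)) \<in> I1 \<times> R2)"
      by (elim bexE) (rule that)
    have "\<exists>i<n. g1 (fst s # xs ! i # replicate (n - 2) e1) \<in> I1"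
      if xs: "xs \<in> nlists n R1" and "g1 xs \<in> I1" for xs
    proof -
      \<comment> \<open>Padding with \<open>e2 \<in> R2\<close> lifts \<open>xs\<close> to the
        product without changing first coordinates; the second coordinate of the product value falls
        in \<open>R2\<close> by closure.\<close>
      define zs where "zs = map (\<lambda>x. (x, e2)) xs"
      have zs: "zs \<in> nlists n (R1 \<times> R2)" "map fst zs = xs"
        using nlists_map_Pair[OF e2 xs] by (simp_all add: zs_def comp_def)
      then have "prod_op g1 g2 zs \<in> I1 \<times> R2"
        using that R2.g_closed by (simp add: prod_op_def nlists_Times_iff)
      with prime[rule_format, OF zs(1)] obtain i where
        "i < n" "g1 (fst s # fst (zs ! i) # replicate (n - 2) e1) \<in> I1"
        by (auto simp: prod_op_def map_replicate)
      then show ?thesis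
        using xs by (auto simp: zs_def)
    qed
    then show ?prime1
      using s by (intro bexI[of _ "fst s"]) auto
  qed
  then show ?thesis
    using assms(5) mult ideal disjoint by (simp only: S_prime_hyperideal_def)
qed

end
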